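(* Let $\Omega$ be a compact subset of $\mathbb R^d$, $\mu$ a probability measure on $\Omega$, and $p\in[1,\infty)$. Let $X_N\subset\mathcal C(\Omega)$ be an $N$-dimensional subspace, $D>0$, $m\in\mathbb N$, and let $\xi=\{\xi^j\}_{j=1}^m$ be points of $\Omega$ such that for each $u\in X_N$ $$\|u\|_p\le D\max_{1\le j\le m}|u(\xi^j)|.$$ Then for any $f\in\mathcal C(\Omega)$ we have $$\|f-\ell\infty(\xi)(f)\|_p\le(2D+1)\,d(f,X_N)_\infty .$$
   Context: $\mathcal C(\Omega)$ is the space of continuous functions on $\Omega$; $\|f\|_p=\left(\int_\Omega|f|^p\,d\mu\right)^{1/p}$ and $\|f\|_\infty=\sup_{\omega\in\Omega}|f(\omega)|$. The best uniform approximation is $d(f,X_N)_\infty:=\inf_{u\in X_N}\|f-u\|_\infty$. The recovery operator is $$\ell\infty(\xi)(f):=\ell\infty(\xi,X_N)(f):=\arg\min_{u\in X_N}\ \max_{1\le j\le m}|f(\xi^j)-u(\xi^j)|,$$ i.e. any (fixed) minimizer. *)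

theory Defs
  imports "HOL-Probability.Probability" "HOL-Library.Function_Algebras"
begin

text \<open>
  The scalars are an arbitrary \<open>real_normed_field\<close>, which covers real-valued and complex-valued
  functions at once.  A function on \<open>\<Omega>\<close> is encoded as a total function vanishing outside \<open>\<Omega>\<close>, so
  that equality of total functions is equality on \<open>\<Omega>\<close> and dimensions are those of spaces of
  functions on \<open>\<Omega>\<close>.
\<close>

definition cont_space :: "'a::topological_space set \<Rightarrow> ('a \<Rightarrow> 'k::real_normed_field) set" where
  "cont_space \<Omega> = {f. continuous_on \<Omega> f \<and> (\<forall>x. x \<notin> \<Omega> \<longrightarrow> f x = 0)}"

definition fun_scale :: "'k::field \<Rightarrow> ('a \<Rightarrow> 'k) \<Rightarrow> 'a \<Rightarrow> 'k" where
  "fun_scale c f = (\<lambda>x. c * f x)"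

global_interpretation fun_vs: vector_space "fun_scale :: 'k::field \<Rightarrow> ('a \<Rightarrow> 'k) \<Rightarrow> 'a \<Rightarrow> 'k"
  by unfold_locales (auto simp: fun_scale_def fun_eq_iff algebra_simps)

text \<open>
  Stated by an explicit finite basis rather than by \<open>dim\<close>, since \<open>dim\<close> is also \<open>0\<close> for
  infinite-dimensional spaces.
\<close>

definition subspace_of_dim :: "nat \<Rightarrow> ('a \<Rightarrow> 'k::field) set \<Rightarrow> bool" where
  "subspace_of_dim N X \<longleftrightarrow>
     (\<exists>B. finite B \<and> card B = N \<and> fun_vs.independent B \<and> fun_vs.span B = X)"

definition Lp_norm :: "'a measure \<Rightarrow> real \<Rightarrow> ('a \<Rightarrow> 'k::real_normed_field) \<Rightarrow> real" where
  "Lp_norm M p f = (LINT x|M. norm (f x) powr p) powr (1 / p)"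

definition sup_norm :: "'a set \<Rightarrow> ('a \<Rightarrow> 'k::real_normed_field) \<Rightarrow> real" where
  "sup_norm \<Omega> f = (SUP x\<in>\<Omega>. norm (f x))"

definition best_unif_approx ::
    "'a set \<Rightarrow> ('a \<Rightarrow> 'k::real_normed_field) \<Rightarrow> ('a \<Rightarrow> 'k) set \<Rightarrow> real" where
  "best_unif_approx \<Omega> f X = (INF u\<in>X. sup_norm \<Omega> (f - u))"

definition sample_max :: "nat \<Rightarrow> (nat \<Rightarrow> 'a) \<Rightarrow> ('a \<Rightarrow> 'k::real_normed_field) \<Rightarrow> real" where
  "sample_max m \<xi> f = Max ((\<lambda>j. norm (f (\<xi> j))) ` {1..m})"

text \<open>
  The set of all minimizers: the recovery operator is any fixed selection from it.
\<close>

definition linf_recovery ::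
    "nat \<Rightarrow> (nat \<Rightarrow> 'a) \<Rightarrow> ('a \<Rightarrow> 'k::real_normed_field) set \<Rightarrow> ('a \<Rightarrow> 'k) \<Rightarrow> ('a \<Rightarrow> 'k) set" where
  "linf_recovery m \<xi> X f = {u. is_arg_min (\<lambda>u. sample_max m \<xi> (f - u)) (\<lambda>u. u \<in> X) u}"

end

theory Submission
  imports Defs
begin

text \<open>
  For \<open>v \<in> X\<close> put \<open>s = sup_norm \<Omega> (f - v)\<close>.  Since \<open>u\<close> minimizes the error at the sample points,
  \<open>v - u\<close> has sample maximum at most \<open>2 * s\<close>, so its \<open>L\<^sub>p\<close> norm is at most \<open>2 * D * s\<close>.  As
  \<open>norm (f - u) \<le> s + norm (v - u)\<close> pointwise on a probability space, the triangle inequality gives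
  the bound \<open>(2 * D + 1) * s\<close>, and one takes the infimum over \<open>v\<close>.
\<close>

text \<open>Jensen's inequality for the power function: with \<open>t = B / (A + B)\<close>,
  \<open>(A + y) / (A + B)\<close> is the convex combination of \<open>1\<close> and
  \<open>y / B\<close> with weights \<open>1 - t\<close> and \<open>t\<close>. The right-hand side
  is affine in \<open>y powr p\<close>, so it can be integrated.\<close>

lemma powr_add_le_convex:
  fixes A B y p :: real
  assumes "A > 0" "B > 0" "y \<ge> 0" "p \<ge> 1"
  shows "(A + y) powr p \<le> (A + B) powr p * (A / (A + B) + B / (A + B) * (y powr p / B powr p))"
proof -
  define t where "t = B / (A + B)"
  have t: "0 < t" "t < 1" "A / (A + B) = 1 - t"
    using assms by (auto simp: t_def field_simps)
  have "((1 - t) + t * (y / B)) powr p \<le> (1 - t) + t * (y / B) powr p"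
  proof (cases "y = 0")
    \<comment> \<open>At the end point \<open>y = 0\<close> of the half-line the claim reduces to
      \<open>(1 - t) powr p \<le> 1 - t\<close>, true as \<open>0 < 1 - t < 1\<close> and
      \<open>p \<ge> 1\<close>.\<close>
    case True
    have "(1 - t) powr p \<le> (1 - t) powr 1"
      using t assms by (intro powr_mono') auto
    then show ?thesis
      using True t by simp
  next
    case False
    then show ?thesis
      using convex_onD[OF powr_convex[OF \<open>p \<ge> 1\<close>], of t 1 "y / B"] t assms by auto
  qed
  moreover have "A + y = (A + B) * ((1 - t) + t * (y / B))"
  proof -
    have "(A + B) * t = B"
      using assms by (simp add: t_def)
    moreover from this have "(A + B) * (1 - t) = A"
      by (simp add: right_diff_distrib)
    ultimately show ?thesis
      using nonzero_mult_div_cancel_left[of B y] \<open>B > 0\<close>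
      by (simp only: distrib_left mult.assoc[symmetric] times_divide_eq_right)
  qed
  moreover have "0 \<le> (1 - t) + t * (y / B)"
    using t assms by (intro add_nonneg_nonneg) auto
  ultimately show ?thesis
    using assms unfolding t(3)
    by (simp add: powr_mult powr_divide t_def[symmetric] mult_left_mono)
qed

text \<open>Minkowski's inequality with one summand constant. Integrating the convexity bound with
  \<open>y = norm (h x)\<close> leaves weights adding up to 1, since the integral of
  \<open>norm (h x) powr p\<close> is at most \<open>B powr p\<close>.\<close>

lemma (in prob_space) Lp_norm_le_const_add:
  fixes g h :: "'a \<Rightarrow> 'k::real_normed_field"
  assumes "p \<ge> 1" "A > 0" "B > 0"
    and int: "integrable M (\<lambda>x. norm (h x) powr p)"
    and le: "\<And>x. x \<in> space M \<Longrightarrow> norm (g x) \<le> A + norm (h x)"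
    and B: "Lp_norm M p h \<le> B"
  shows "Lp_norm M p g \<le> A + B"
proof -
  let ?I = "LINT x|M. norm (h x) powr p"
  let ?b = "\<lambda>x. (A + B) powr p * (A / (A + B) + B / (A + B) * (norm (h x) powr p / B powr p))"
  have "?I = Lp_norm M p h powr p"
    using assms by (simp add: Lp_norm_def powr_powr)
  also have "\<dots> \<le> B powr p"
    using assms by (intro powr_mono2) (auto simp: Lp_norm_def)
  finally have I: "?I / B powr p \<le> 1"
    using assms by simp
  \<comment> \<open>Only the majorant has to be integrable: if the left integrand is not, its
    integral is 0 by convention, and \<open>?b\<close> is nonnegative.\<close>
  have "(LINT x|M. norm (g x) powr p) \<le> (LINT x|M. ?b x)"
  proof (rule integral_mono')
    show "integrable M ?b"
      using int by auto
    show "norm (g x) powr p \<le> ?b x" if "x \<in> space M" for x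
    proof -
      have "norm (g x) powr p \<le> (A + norm (h x)) powr p"
        using le[OF that] assms by (intro powr_mono2) auto
      also have "\<dots> \<le> ?b x"
        using assms by (intro powr_add_le_convex) auto
      finally show ?thesis .
    qed
    show "0 \<le> ?b x" for x
      using assms by (intro mult_nonneg_nonneg add_nonneg_nonneg) auto
  qed
  \<comment> \<open>Total mass 1 makes the constant \<open>A / (A + B)\<close> integrate to
    itself.\<close>
  also have "\<dots> = (A + B) powr p * (A / (A + B) + B / (A + B) * (?I / B powr p))"
    using int by (simp add: prob_space)
  also have "\<dots> \<le> (A + B) powr p * (A / (A + B) + B / (A + B) * 1)"
    using assms I by (intro mult_left_mono add_left_mono) auto
  also have "\<dots> = (A + B) powr p"
    using assms by (simp add: add_divide_distrib[symmetric])
  finally have "Lp_norm M p g \<le> ((A + B) powr p) powr (1 / p)"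
    unfolding Lp_norm_def using assms by (intro powr_mono2 integral_nonneg_AE) auto
  then show ?thesis
    using assms by (simp add: powr_powr)
qed

lemma cont_space_diff:
  "f \<in> cont_space \<Omega> \<Longrightarrow> g \<in> cont_space \<Omega> \<Longrightarrow> f - g \<in> cont_space \<Omega>"
  by (auto simp: cont_space_def fun_diff_def intro!: continuous_intros)

lemma bdd_above_norm_cont_space:
  fixes f :: "'a::topological_space \<Rightarrow> 'k::real_normed_field"
  assumes "compact \<Omega>" "f \<in> cont_space \<Omega>"
  shows "bdd_above ((\<lambda>x. norm (f x)) ` \<Omega>)"
proof -
  have "compact ((\<lambda>x. norm (f x)) ` \<Omega>)"
    using assms by (intro compact_continuous_image continuous_on_norm) (auto simp: cont_space_def)
  then show ?thesis
    by (intro bounded_imp_bdd_above compact_imp_bounded)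
qed

lemma norm_le_sup_norm:
  assumes "compact \<Omega>" "f \<in> cont_space \<Omega>" "x \<in> \<Omega>"
  shows "norm (f x) \<le> sup_norm \<Omega> f"
  unfolding sup_norm_def using assms by (intro cSUP_upper bdd_above_norm_cont_space)

text \<open>Continuity gives Borel measurability on \<open>\<Omega>\<close>, which passes to the
  possibly larger sigma-algebra of \<open>\<mu>\<close>; compactness gives boundedness, enough for a
  finite measure.\<close>

lemma integrable_norm_powr_cont_space:
  fixes f :: "'a::topological_space \<Rightarrow> 'k::real_normed_field"
  assumes "compact \<Omega>" "f \<in> cont_space \<Omega>" "p \<ge> 0"
    and "finite_measure \<mu>" "space \<mu> = \<Omega>" "sets (restrict_space borel \<Omega>) \<subseteq> sets \<mu>"
  shows "integrable \<mu> (\<lambda>x. norm (f x) powr p)"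
proof -
  interpret finite_measure \<mu> by fact
  have "(\<lambda>x. norm (f x)) \<in> borel_measurable (restrict_space borel \<Omega>)"
    using assms
    by (intro borel_measurable_continuous_on_restrict continuous_on_norm) (auto simp: cont_space_def)
  then have [measurable]: "(\<lambda>x. norm (f x)) \<in> borel_measurable \<mu>"
    using measurable_mono[of borel borel "restrict_space borel \<Omega>" \<mu>] assms
    by (auto simp: space_restrict_space)
  have "norm (norm (f x) powr p) \<le> sup_norm \<Omega> f powr p" if "x \<in> space \<mu>" for x
    using norm_le_sup_norm[of \<Omega> f x] that assms by (auto intro!: powr_mono2)
  then show ?thesis
    by (intro integrable_const_bound[where B = "sup_norm \<Omega> f powr p"]) auto
qed

lemma norm_le_sample_max:
  "j \<in> {1..m} \<Longrightarrow> norm (f (\<xi> j)) \<le> sample_max m \<xi> f"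
  by (auto simp: sample_max_def intro!: Max_ge)

text \<open>\<open>m \<ge> 1\<close> keeps \<open>Max\<close> away from the empty set, where its
  value is unspecified.\<close>

lemma sample_max_le:
  assumes "m \<ge> 1" "\<And>j. j \<in> {1..m} \<Longrightarrow> norm (f (\<xi> j)) \<le> c"
  shows "sample_max m \<xi> f \<le> c"
  using assms by (auto simp: sample_max_def)

lemma subspace_of_dim_diff:
  assumes "subspace_of_dim N X" "u \<in> X" "v \<in> X"
  shows "u - v \<in> X"
  using assms by (auto simp: subspace_of_dim_def intro: fun_vs.span_diff)

lemma subspace_of_dim_nonempty:
  assumes "subspace_of_dim N X"
  shows "X \<noteq> {}"
  using assms fun_vs.span_zero by (auto simp: subspace_of_dim_def)

lemma sample_max_diff_recovery_le:
  assumes "m \<ge> 1" "u \<in> linf_recovery m \<xi> X f" "v \<in> X"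
  shows "sample_max m \<xi> (v - u) \<le> 2 * sample_max m \<xi> (f - v)"
proof (rule sample_max_le)
  fix j assume j: "j \<in> {1..m}"
  have "norm ((v - u) (\<xi> j)) = norm ((f - u) (\<xi> j) - (f - v) (\<xi> j))"
    by simp
  also have "\<dots> \<le> norm ((f - u) (\<xi> j)) + norm ((f - v) (\<xi> j))"
    by (rule norm_triangle_ineq4)
  also have "\<dots> \<le> sample_max m \<xi> (f - u) + sample_max m \<xi> (f - v)"
    using j by (intro add_mono norm_le_sample_max)
  \<comment> \<open>Minimality of \<open>u\<close>, tested against the competitor
    \<open>v\<close>.\<close>
  also have "\<dots> \<le> 2 * sample_max m \<xi> (f - v)"
    using assms by (auto simp: linf_recovery_def is_arg_min_linorder)
  finally show "norm ((v - u) (\<xi> j)) \<le> 2 * sample_max m \<xi> (f - v)" .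
qed fact

theorem theorem5p2:
  fixes \<Omega> :: "(real ^ 'd) set"
    and \<mu> :: "(real ^ 'd) measure"
    and p D :: real
    and N m :: nat
    and X :: "(real ^ 'd \<Rightarrow> 'k::real_normed_field) set"
    and \<xi> :: "nat \<Rightarrow> real ^ 'd"
  assumes "compact \<Omega>"
    and "prob_space \<mu>" and "space \<mu> = \<Omega>" and "sets (restrict_space borel \<Omega>) \<subseteq> sets \<mu>"
    and "1 \<le> p"
    and "X \<subseteq> cont_space \<Omega>" and "subspace_of_dim N X"
    and "D > 0"
    and "m \<ge> 1" and "\<forall>j\<in>{1..m}. \<xi> j \<in> \<Omega>"
    and "\<forall>u\<in>X. Lp_norm \<mu> p u \<le> D * sample_max m \<xi> u"
  shows "\<forall>f\<in>cont_space \<Omega>. \<forall>u\<in>linf_recovery m \<xi> X f.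
           Lp_norm \<mu> p (f - u) \<le> (2 * D + 1) * best_unif_approx \<Omega> f X"
proof (intro ballI)
  fix f u
  assume f: "f \<in> cont_space \<Omega>" and u: "u \<in> linf_recovery m \<xi> X f"
  interpret prob_space \<mu> by fact
  have "u \<in> X"
    using u by (simp add: linf_recovery_def is_arg_min_def)
  have "Lp_norm \<mu> p (f - u) / (2 * D + 1) \<le> sup_norm \<Omega> (f - v)" if v: "v \<in> X" for v
  \<comment> \<open>Working with \<open>A > sup_norm \<Omega> (f - v)\<close> avoids the degenerate case \<open>f = v\<close>.\<close>
  proof (rule dense_ge)
    fix A assume A: "sup_norm \<Omega> (f - v) < A"
    have fv: "f - v \<in> cont_space \<Omega>" and vu: "v - u \<in> X"
      using f v \<open>u \<in> X\<close> assms(6,7) by (auto intro: cont_space_diff subspace_of_dim_diff)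
    have le_A: "norm ((f - v) x) \<le> A" if "x \<in> \<Omega>" for x
      using norm_le_sup_norm[OF \<open>compact \<Omega>\<close> fv that] A by simp
    \<comment> \<open>A probability space is nonempty, so the supremum dominates the norm of some
      value.\<close>
    have "0 \<le> sup_norm \<Omega> (f - v)"
      using norm_le_sup_norm[OF \<open>compact \<Omega>\<close> fv] not_empty \<open>space \<mu> = \<Omega>\<close>
      by (metis ex_in_conv norm_ge_zero order_trans)
    then have "A > 0"
      using A by simp
    have "sample_max m \<xi> (f - v) \<le> A"
      using assms(9,10) le_A by (intro sample_max_le) auto
    then have "sample_max m \<xi> (v - u) \<le> 2 * A"
      using sample_max_diff_recovery_le[OF \<open>m \<ge> 1\<close> u v] by simp
    then have "D * sample_max m \<xi> (v - u) \<le> D * (2 * A)"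
      using \<open>D > 0\<close> by simp
    then have "Lp_norm \<mu> p (v - u) \<le> D * (2 * A)"
      using assms(11) vu by (meson order_trans)
    moreover have "norm ((f - u) x) \<le> A + norm ((v - u) x)" if "x \<in> space \<mu>" for x
      using norm_triangle_ineq[of "(f - v) x" "(v - u) x"] le_A[of x] that \<open>space \<mu> = \<Omega>\<close> by simp
    moreover have "integrable \<mu> (\<lambda>x. norm ((v - u) x) powr p)"
      using \<open>1 \<le> p\<close>
      by (intro integrable_norm_powr_cont_space[OF assms(1) subsetD[OF assms(6) vu] _
          finite_measure_axioms assms(3,4)]) simp
    \<comment> \<open>Here \<open>B = D * (2 * A)\<close>, positive because \<open>A\<close> and
      \<open>D\<close> are; the sum \<open>A + B\<close> is \<open>(2 * D + 1) * A\<close>.\<close>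
    ultimately have "Lp_norm \<mu> p (f - u) \<le> A + D * (2 * A)"
      using \<open>1 \<le> p\<close> \<open>A > 0\<close> \<open>D > 0\<close> by (intro Lp_norm_le_const_add[where h = "v - u"]) auto
    then show "Lp_norm \<mu> p (f - u) / (2 * D + 1) \<le> A"
      using \<open>D > 0\<close> by (simp add: field_simps)
  qed
  \<comment> \<open>The quotient does not depend on \<open>v\<close>, so it is a lower bound for all
    the errors whose infimum is taken.\<close>
  then have "Lp_norm \<mu> p (f - u) / (2 * D + 1) \<le> best_unif_approx \<Omega> f X"
    unfolding best_unif_approx_def
    using subspace_of_dim_nonempty[OF assms(7)] by (intro cINF_greatest)
  then show "Lp_norm \<mu> p (f - u) \<le> (2 * D + 1) * best_unif_approx \<Omega> f X"
    using \<open>D > 0\<close> by (simp add: field_simps)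
qed

end
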